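(* Let $t_1(q)=\frac13\big(2\theta_3(q^2)\theta_3(q^6)-\theta_3(-q^2)\theta_3(-q^6)\big)=\sum_{k=0}^\infty t_{1,k}q^k$. Let $k$ be a non-negative integer. If $k=4m$ for some $m\in\mathbb{Z}$, then the equation $x^2+3y^2=k$ has exactly $3t_{1,k}$ integer solutions $(x,y)$; otherwise the equation has exactly $t_{1,k}$ integer solutions.
   Context: $\theta_3(q)=1+2\sum_{k=1}^\infty q^{\frac12k^2}$, so $\theta_3(q^{2r})=1+2\sum_{k\ge1}q^{rk^2}$ for $r\in\mathbb{N}$. The symbols $\theta_3(-q^2)$ and $\theta_3(-q^6)$ denote $1+2\sum_{k\ge1}(-1)^kq^{k^2}$ and $1+2\sum_{k\ge1}(-1)^kq^{3k^2}$ respectively. *)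

theory Defs
  imports "HOL-Analysis.Analysis" "HOL-Computational_Algebra.Formal_Power_Series"
begin

text \<open>
  All series are formal power series in \<open>q = fps_X\<close>, and infinite sums are taken in the
  \<open>q\<close>-adic topology.  Since \<open>\<theta>\<^sub>3(q)\<close> itself involves the half-integral powers \<open>q\<^bsup>k^2/2\<^esup>\<close>, only its
  specialisations at \<open>\<plusminus>q\<^bsup>2r\<^esup>\<close> are defined.  The one at \<open>-q\<^bsup>2r\<^esup>\<close> is a convention for the
  alternating series: \<open>(-q\<^bsup>2r\<^esup>)\<^bsup>k^2/2\<^esup>\<close> is read as \<open>(-1)\<^bsup>k\<^esup> q\<^bsup>rk^2\<^esup>\<close>.
  The summation index is shifted, the \<open>k\<close>-th summand being the one for \<open>k + 1\<close>.
  Both series converge only for \<open>r > 0\<close>.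
\<close>

definition theta3_pos :: "nat \<Rightarrow> real fps" where
  "theta3_pos r = 1 + 2 * (\<Sum>k. fps_X ^ (r * (Suc k)\<^sup>2))"

definition theta3_neg :: "nat \<Rightarrow> real fps" where
  "theta3_neg r = 1 + 2 * (\<Sum>k. (-1) ^ Suc k * fps_X ^ (r * (Suc k)\<^sup>2))"

definition t1 :: "real fps" where
  "t1 = fps_const (1/3) * (2 * theta3_pos 1 * theta3_pos 3 - theta3_neg 1 * theta3_neg 3)"

lemma summable_theta3_general:
  fixes c :: "nat \<Rightarrow> real fps"
  assumes "r > 0"
  shows "summable (\<lambda>k. c k * fps_X ^ (r * (Suc k)\<^sup>2))"
proof -
  define f where "f = (\<lambda>k. c k * fps_X ^ (r * (Suc k)\<^sup>2))"
  have nth_f: "fps_nth (f k) n = 0" if "n \<le> k" for k n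
  proof -
    have "k < Suc k * Suc k" by simp
    also have "\<dots> \<le> r * (Suc k)\<^sup>2"
      using mult_le_mono1[of 1 r "Suc k * Suc k"] assms by (simp add: power2_eq_square)
    finally have "n < r * (Suc k)\<^sup>2" using that by simp
    then show ?thesis by (simp add: f_def fps_X_power_mult_right_nth)
  qed
  define S where "S = Abs_fps (\<lambda>n. \<Sum>k<n. fps_nth (f k) n)"
  have "(\<lambda>N. \<Sum>k<N. f k) \<longlonglongrightarrow> S"
  proof (rule tendsto_fpsI)
    fix n
    have "fps_nth (\<Sum>k<N. f k) n = fps_nth S n" if "N \<ge> n" for N
    proof -
      have "(\<Sum>k<n. fps_nth (f k) n) = (\<Sum>k<N. fps_nth (f k) n)"
        using that nth_f by (intro sum.mono_neutral_left) auto
      then show ?thesis by (simp add: S_def fps_sum_nth)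
    qed
    then show "eventually (\<lambda>N. fps_nth (\<Sum>k<N. f k) n = fps_nth S n) sequentially"
      by (auto simp: eventually_sequentially)
  qed
  then have "f sums S" by (simp add: sums_def)
  then show ?thesis by (simp add: f_def sums_iff)
qed

lemma summable_theta3_pos:
  "r > 0 \<Longrightarrow> summable (\<lambda>k. fps_X ^ (r * (Suc k)\<^sup>2) :: real fps)"
  using summable_theta3_general[of r "\<lambda>_. 1"] by simp

lemma summable_theta3_neg:
  "r > 0 \<Longrightarrow> summable (\<lambda>k. (-1) ^ Suc k * fps_X ^ (r * (Suc k)\<^sup>2) :: real fps)"
  by (rule summable_theta3_general)

end

theory Submission
  imports Defs
begin

text \<open>
  Write \<open>N(k)\<close> for the number of representations \<open>k = x\<^sup>2 + 3y\<^sup>2\<close>.  Summing over all integers instead of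
  the positive ones, \<open>\<theta>\<^sub>3(q\<^bsup>2r\<^esup>)\<close> is \<open>\<Sum>\<^sub>x q\<^bsup>rx^2\<^esup>\<close>, so \<open>F(q) = \<theta>\<^sub>3(q\<^sup>2) \<theta>\<^sub>3(q\<^sup>6)\<close> is the generating
  function of \<open>N\<close>.  For odd \<open>r\<close> the exponent \<open>rx\<^sup>2\<close> has the parity of \<open>x\<close>, so the alternating series
  are the plain ones at \<open>-q\<close>, and \<open>\<theta>\<^sub>3(-q\<^sup>2) \<theta>\<^sub>3(-q\<^sup>6) = F(-q)\<close>.  Comparing coefficients in
  \<open>t\<^sub>1(q) = (2 F(q) - F(-q)) / 3\<close> gives \<open>N(k)\<close> for odd \<open>k\<close> and \<open>N(k) / 3\<close> for even \<open>k\<close>.  This is the claim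
  except when \<open>k\<close> is twice an odd number, and there \<open>N(k) = 0\<close>: if \<open>x\<^sup>2 + 3y\<^sup>2\<close> is even, then \<open>x\<close> and \<open>y\<close>
  have the same parity and \<open>x\<^sup>2 + 3y\<^sup>2\<close> is a multiple of \<open>4\<close>.

  The series \<open>F(q)\<close> and \<open>F(-q)\<close> are treated together as \<open>F(cq)\<close> with a real constant \<open>c\<close>.  The
  coefficient of \<open>q\<^sup>k\<close> in a product only sees the factors up to degree \<open>k\<close>, so both theta series can be
  replaced by finite sums over \<open>-k \<le> x \<le> k\<close>.
\<close>

text \<open>The series \<open>\<theta>\<^sub>3(q\<^bsup>2r\<^esup>)\<close> after the substitution \<open>q \<mapsto> cq\<close>.\<close>

definition theta3_scaled :: "real \<Rightarrow> nat \<Rightarrow> real fps" where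
  "theta3_scaled c r = 1 + 2 * (\<Sum>k. (fps_const c * fps_X) ^ (r * (Suc k)\<^sup>2))"

definition theta3_partial :: "real \<Rightarrow> nat \<Rightarrow> nat \<Rightarrow> real fps" where
  "theta3_partial c r N =
    (\<Sum>x\<in>{-int N..int N}. (fps_const c * fps_X) ^ (r * (nat \<bar>x\<bar>)\<^sup>2))"

lemma theta3_pos_eq_scaled: "theta3_pos r = theta3_scaled 1 r"
  by (simp add: theta3_pos_def theta3_scaled_def)

lemma theta3_neg_eq_scaled:
  assumes "odd r"
  shows "theta3_neg r = theta3_scaled (-1) r"
proof -
  have "(-1) ^ Suc k * fps_X ^ (r * (Suc k)\<^sup>2) =
      (fps_const (-1) * fps_X :: real fps) ^ (r * (Suc k)\<^sup>2)" for k
  proof -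
    have "even (r * (Suc k)\<^sup>2) = even (Suc k)"
      using assms by simp
    then have "(-1 :: real fps) ^ Suc k = (-1) ^ (r * (Suc k)\<^sup>2)"
      by (simp only: minus_one_power_iff)
    moreover have "fps_const (-1 :: real) = -1"
      by (simp flip: fps_const_neg)
    ultimately show ?thesis
      by (simp only: power_mult_distrib)
  qed
  then show ?thesis
    by (simp only: theta3_neg_def theta3_scaled_def)
qed

lemma scaled_X_power_nth:
  "fps_nth ((fps_const (c::real) * fps_X) ^ e) n = (if n = e then c ^ e else 0)"
  by (simp add: power_mult_distrib fps_const_power fps_X_power_nth)

text \<open>Each square of a positive integer is met at two integers \<open>\<plusminus>(k + 1)\<close>, whence the factor \<open>2\<close>.\<close>

lemma theta3_partial_eq:
  "theta3_partial c r N = 1 + 2 * (\<Sum>k<N. (fps_const c * fps_X) ^ (r * (Suc k)\<^sup>2))"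
proof (induction N)
  case 0
  then show ?case by (simp add: theta3_partial_def)
next
  case (Suc N)
  have "{-int (Suc N)..int (Suc N)} =
      insert (int (Suc N)) (insert (- int (Suc N)) {-int N..int N})"
    by auto
  moreover have "nat \<bar>int (Suc N)\<bar> = Suc N" "nat \<bar>- int (Suc N)\<bar> = Suc N"
    by simp_all
  ultimately have "theta3_partial c r (Suc N) =
      2 * (fps_const c * fps_X) ^ (r * (Suc N)\<^sup>2) + theta3_partial c r N"
    unfolding theta3_partial_def by (simp del: of_nat_Suc abs_minus_cancel)
  then show ?case
    by (simp only: Suc.IH sum.lessThan_Suc) (simp add: algebra_simps)
qed

text \<open>A summand with index \<open>j \<ge> N\<close> has degree \<open>r(j + 1)\<^sup>2 > N\<close>.\<close>

lemma theta3_scaled_nth_eq_partial: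
  assumes "r > 0" "n \<le> N"
  shows "fps_nth (theta3_scaled c r) n = fps_nth (theta3_partial c r N) n"
proof -
  define f :: "nat \<Rightarrow> real fps" where "f = (\<lambda>k. (fps_const c * fps_X) ^ (r * (Suc k)\<^sup>2))"
  have "f = (\<lambda>k. fps_const c ^ (r * (Suc k)\<^sup>2) * fps_X ^ (r * (Suc k)\<^sup>2))"
    by (simp add: f_def power_mult_distrib)
  then have "summable f"
    using summable_theta3_general[OF assms(1)] by simp
  then have "(\<lambda>M. \<Sum>k<M. f k) \<longlonglongrightarrow> suminf f"
    by (rule summable_LIMSEQ)
  then have "\<forall>\<^sub>F M in sequentially. fps_nth (\<Sum>k<M. f k) n = fps_nth (suminf f) n"
    by (simp add: tendsto_fps_iff)
  then obtain M0 where M0: "fps_nth (\<Sum>k<M. f k) n = fps_nth (suminf f) n" if "M \<ge> M0" for M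
    by (auto simp: eventually_sequentially)
  have zero: "fps_nth (f j) n = 0" if "N \<le> j" for j
  proof -
    have "n < Suc j"
      using assms(2) that by simp
    also have "Suc j \<le> r * (Suc j)\<^sup>2"
      using mult_le_mono[of 1 r "Suc j" "(Suc j)\<^sup>2"] assms(1) self_le_power[of "Suc j" 2] by simp
    finally show ?thesis
      by (simp add: f_def scaled_X_power_nth)
  qed
  have "fps_nth (\<Sum>k<N. f k) n = fps_nth (\<Sum>k<max M0 N. f k) n"
    unfolding fps_sum_nth using zero by (intro sum.mono_neutral_left) auto
  also have "\<dots> = fps_nth (suminf f) n"
    by (rule M0) simp
  finally show ?thesis
    by (simp add: theta3_scaled_def theta3_partial_eq f_def flip: mult_2)
qed

lemma abs_le_of_square_le:
  assumes "(x::int)\<^sup>2 \<le> int k"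
  shows "\<bar>x\<bar> \<le> int k"
proof -
  have "\<bar>x\<bar> \<le> x\<^sup>2"
    using self_le_power[of "\<bar>x\<bar>" 2] by (cases "x = 0") simp_all
  then show ?thesis using assms by simp
qed

lemma representations_subset_box:
  "{(x::int, y::int). x\<^sup>2 + 3 * y\<^sup>2 = int k} \<subseteq> {-int k..int k} \<times> {-int k..int k}"
proof clarify
  fix x y :: int
  assume eq: "x\<^sup>2 + 3 * y\<^sup>2 = int k"
  have "\<bar>x\<bar> \<le> int k" "\<bar>y\<bar> \<le> int k"
    by (rule abs_le_of_square_le; use eq zero_le_power2[of x] zero_le_power2[of y] in linarith)+
  then show "x \<in> {-int k..int k} \<and> y \<in> {-int k..int k}"
    by auto
qed

lemma finite_representations: "finite {(x::int, y::int). x\<^sup>2 + 3 * y\<^sup>2 = int k}"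
  by (rule finite_subset[OF representations_subset_box]) simp

text \<open>
  A pair \<open>(x, y)\<close> contributes the monomial \<open>(cq)\<^bsup>x^2 + 3y^2\<^esup>\<close> to the product, and the truncation at
  \<open>\<plusminus>k\<close> loses none of the pairs that represent \<open>k\<close>.
\<close>

lemma theta3_scaled_product_nth:
  "fps_nth (theta3_scaled c 1 * theta3_scaled c 3) k =
    c ^ k * real (card {(x::int, y::int). x\<^sup>2 + 3 * y\<^sup>2 = int k})"
proof -
  let ?B = "{-int k..int k} \<times> {-int k..int k}"
  let ?R = "{(x::int, y::int). x\<^sup>2 + 3 * y\<^sup>2 = int k}"
  let ?e = "\<lambda>(x::int, y::int). (nat \<bar>x\<bar>)\<^sup>2 + 3 * (nat \<bar>y\<bar>)\<^sup>2"
  have e_iff: "?e p = k \<longleftrightarrow> p \<in> ?R" for p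
  proof -
    have "int (?e p) = (case p of (x, y) \<Rightarrow> x\<^sup>2 + 3 * y\<^sup>2)"
      by (simp split: prod.split)
    moreover have "?e p = k \<longleftrightarrow> int (?e p) = int k"
      by (simp only: of_nat_eq_iff)
    ultimately show ?thesis by (simp add: case_prod_unfold)
  qed
  have "fps_nth (theta3_scaled c 1 * theta3_scaled c 3) k =
      fps_nth (theta3_partial c 1 k * theta3_partial c 3 k) k"
    unfolding fps_mult_nth by (intro sum.cong) (simp_all add: theta3_scaled_nth_eq_partial[of _ _ k])
  also have "theta3_partial c 1 k * theta3_partial c 3 k = (\<Sum>p\<in>?B. (fps_const c * fps_X) ^ ?e p)"
    unfolding theta3_partial_def sum_product sum.cartesian_product
    by (intro sum.cong) (auto simp: power_add)
  also have "fps_nth \<dots> k = (\<Sum>p\<in>?B. if p \<in> ?R then c ^ k else 0)"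
    unfolding fps_sum_nth
  proof (intro sum.cong refl)
    fix p
    show "fps_nth ((fps_const c * fps_X) ^ ?e p) k = (if p \<in> ?R then c ^ k else 0)"
      unfolding scaled_X_power_nth e_iff[symmetric] by auto
  qed
  also have "\<dots> = (\<Sum>p\<in>?B \<inter> ?R. c ^ k)"
    by (rule sum.inter_restrict[symmetric]) simp
  also have "?B \<inter> ?R = ?R"
    using representations_subset_box by blast
  finally show ?thesis by simp
qed

lemma t1_nth:
  "fps_nth t1 k = (2 - (-1) ^ k) / 3 * real (card {(x::int, y::int). x\<^sup>2 + 3 * y\<^sup>2 = int k})"
proof -
  have t1_eq: "t1 = fps_const (1/3) * (fps_const 2 * (theta3_scaled 1 1 * theta3_scaled 1 3)
      - theta3_scaled (-1) 1 * theta3_scaled (-1) 3)"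
    by (simp add: t1_def theta3_pos_eq_scaled theta3_neg_eq_scaled mult.assoc numeral_fps_const)
  show ?thesis
    unfolding t1_eq fps_mult_left_const_nth fps_sub_nth theta3_scaled_product_nth
    by (simp add: field_simps)
qed

lemma four_dvd_if_even_x2_plus_3y2:
  fixes x y :: int
  assumes "even (x\<^sup>2 + 3 * y\<^sup>2)"
  shows "4 dvd x\<^sup>2 + 3 * y\<^sup>2"
proof -
  have "even (x + y)" "even (x - y)"
    using assms by auto
  then have "2 * 2 dvd (x + y) * (x - y)"
    by (rule mult_dvd_mono)
  moreover have "x\<^sup>2 + 3 * y\<^sup>2 = (x + y) * (x - y) + 4 * y\<^sup>2"
    by (simp add: power2_eq_square algebra_simps)
  ultimately show ?thesis by simp
qed

theorem proposition8p2:
  fixes k :: nat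
  shows "finite {(x::int, y::int). x\<^sup>2 + 3 * y\<^sup>2 = int k} \<and>
    (if \<exists>m::int. int k = 4 * m
     then real (card {(x::int, y::int). x\<^sup>2 + 3 * y\<^sup>2 = int k}) = 3 * fps_nth t1 k
     else real (card {(x::int, y::int). x\<^sup>2 + 3 * y\<^sup>2 = int k}) = fps_nth t1 k)"
proof (intro conjI finite_representations)
  let ?R = "{(x::int, y::int). x\<^sup>2 + 3 * y\<^sup>2 = int k}"
  have "real (card ?R) = 3 * fps_nth t1 k" if "4 dvd int k"
  proof -
    have "even k"
      using that by presburger
    then show ?thesis by (simp add: t1_nth)
  qed
  moreover have "real (card ?R) = fps_nth t1 k" if "\<not> 4 dvd int k"
  proof (cases "even k")
    case True
    then have "x\<^sup>2 + 3 * y\<^sup>2 \<noteq> int k" for x y :: int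
      using that four_dvd_if_even_x2_plus_3y2[of x y] by (metis even_of_nat)
    then have "?R = {}"
      by simp
    then have "card ?R = 0"
      by (simp only: card.empty)
    then show ?thesis by (simp add: t1_nth)
  next
    case False
    then show ?thesis by (simp add: t1_nth)
  qed
  ultimately show "if \<exists>m::int. int k = 4 * m
     then real (card ?R) = 3 * fps_nth t1 k
     else real (card ?R) = fps_nth t1 k"
    by (simp add: dvd_def)
qed

end
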